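(* For each integer $n\ge1$ let $\theta_r^{(n)}$ and $\eta_r^{(n)}$ be the polynomial coefficients in the representations $\mathcal{V}_n=\sum_{r\ge 0}\theta_r^{(n)}D^r$ and $\mathcal{V}_n^{-1}=\sum_{r\ge0}\eta_r^{(n)}D^r$ of the Baskakov operator and its inverse on the space of polynomials. Put $X=x(1+x)$. Then for every integer $r\ge 1$ (with the convention $\frac{1}{(-1)!}=0$ when $r=1$) and every $x$, as $n\to+\infty$, $$\lim n^r\theta_{2r-1}^{(n)}(x)=\frac{1}{3\cdot 2^{r-1}(r-2)!}(1+2x)X^{r-1},\qquad \lim n^r\theta_{2r}^{(n)}(x)=\frac{1}{2^r r!}X^r,$$ $$\lim n^r\eta_{2r-1}^{(n)}(x)=\frac{(-1)^r}{3\cdot 2^{r-2}(r-2)!}(1+2x)X^{r-1},\qquad \lim n^r\eta_{2r}^{(n)}(x)=\frac{(-1)^r}{2^r r!}X^r.$$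
   Context: $D=d/dx$, and $\mathbb{P}$ is the space of real polynomials in one variable. For an integer $n\ge1$ the Baskakov operator is $$\mathcal{V}_nf(x)=\sum_{k\ge 0} f\left(\tfrac kn\right) v_{k,n}(x),\qquad v_{k,n}(x)=\binom{n+k-1}{k}x^k(1+x)^{-(n+k)},\quad x\ge 0.$$ For a polynomial $f$ the series converges for every $x\ge0$ and its sum is (the restriction to $[0,\infty)$ of) a polynomial of the same degree as $f$; thus $\mathcal{V}_n$ is a degree-preserving linear isomorphism of $\mathbb{P}$. Explicitly, $\mathcal{V}_n$ maps $\prod_{i=0}^{r-1}(x-\frac in)$ to $\frac{n(n+1)\cdots(n+r-1)}{n^r}x^r$. Every linear operator on $\mathbb{P}$ can be written uniquely as $\sum_{r\ge0}a_r(x)D^r$ with polynomial coefficients $a_r$ (the sum is finite when applied to any given polynomial); $\theta_r^{(n)}$ and $\eta_r^{(n)}$ are these coefficients for $\mathcal{V}_n$ and $\mathcal{V}_n^{-1}$ respectively. *)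

theory Defs
  imports "HOL-Analysis.Analysis" "HOL-Computational_Algebra.Polynomial"
begin

definition baskakov_basis :: "nat \<Rightarrow> nat \<Rightarrow> real \<Rightarrow> real" where
  "baskakov_basis k n x = real ((n + k - 1) choose k) * x ^ k / (1 + x) ^ (n + k)"

definition baskakov :: "nat \<Rightarrow> (real \<Rightarrow> real) \<Rightarrow> real \<Rightarrow> real" where
  "baskakov n f x = (\<Sum>k. f (real k / real n) * baskakov_basis k n x)"

definition baskakov_poly :: "nat \<Rightarrow> real poly \<Rightarrow> real poly" where
  "baskakov_poly n p = (THE q. \<forall>x\<ge>0. poly q x = baskakov n (poly p) x)"

text \<open>All derivatives of order above \<open>degree p\<close> vanish, so the truncated sum is the
  full (formally infinite) series \<open>\<Sum>r\<ge>0. a r * D\<^sup>r p\<close>.\<close>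

definition diff_op_rep :: "(real poly \<Rightarrow> real poly) \<Rightarrow> (nat \<Rightarrow> real poly) \<Rightarrow> bool" where
  "diff_op_rep L a \<longleftrightarrow> (\<forall>p. L p = (\<Sum>r\<le>degree p. a r * (pderiv ^^ r) p))"

definition diff_op_coeff :: "(real poly \<Rightarrow> real poly) \<Rightarrow> nat \<Rightarrow> real poly" where
  "diff_op_coeff L = (THE a. diff_op_rep L a)"

definition theta :: "nat \<Rightarrow> nat \<Rightarrow> real poly" where
  "theta n r = diff_op_coeff (baskakov_poly n) r"

definition eta :: "nat \<Rightarrow> nat \<Rightarrow> real poly" where
  "eta n r = diff_op_coeff (inv (baskakov_poly n)) r"

text \<open>\<open>1 / m!\<close> for an integer \<open>m\<close>, with the usual value \<open>0\<close> at negative \<open>m\<close>.\<close>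

definition inv_fact :: "int \<Rightarrow> real" where
  "inv_fact m = (if m < 0 then 0 else 1 / fact (nat m))"


text \<open>The definite descriptions above are meaningful: for \<open>n \<ge> 1\<close> the series converges to
  a polynomial, \<open>baskakov_poly n\<close> is a linear bijection, and every linear operator has exactly
  one coefficient sequence.\<close>

lemma baskakov_basis_sums_1:
  assumes "n \<ge> 1" "x \<ge> 0"
  shows "(\<lambda>k. baskakov_basis k n x) sums 1"
proof -
  define z where "z = - x / (1 + x)"
  have "\<bar>z\<bar> < 1" using assms by (simp add: z_def)
  from gen_binomial_real[OF this, of "- real n"]
  have s: "(\<lambda>k. (- real n gchoose k) * z ^ k) sums (1 + z) powr (- real n)" .
  have z1: "1 + z = 1 / (1 + x)" using assms by (simp add: z_def field_simps)
  have e: "(1 + z) powr (- real n) = (1 + x) ^ n"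
    using assms by (simp add: z1 powr_minus powr_realpow power_one_over)
  have t: "(- real n gchoose k) * z ^ k = real ((n + k - 1) choose k) * (x / (1 + x)) ^ k" for k
  proof -
    have "(- real n gchoose k) = (- 1) ^ k * ((real n + real k - 1) gchoose k)"
      by (rule gbinomial_minus)
    also have "real n + real k - 1 = real (n + k - 1)" using assms by simp
    also have "(real (n + k - 1) gchoose k) = real ((n + k - 1) choose k)"
      by (simp add: binomial_gbinomial)
    finally have "(- real n gchoose k) * z ^ k
      = real ((n + k - 1) choose k) * ((- 1) ^ k * z ^ k)" by simp
    also have "(- 1) ^ k * z ^ k = (x / (1 + x)) ^ k"
      by (simp add: z_def power_mult_distrib [symmetric])
    finally show ?thesis .
  qed
  have "(\<lambda>k. real ((n + k - 1) choose k) * (x / (1 + x)) ^ k / (1 + x) ^ n)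
          sums ((1 + x) ^ n / (1 + x) ^ n)"
    using sums_divide[OF s, of "(1 + x) ^ n"] unfolding t e .
  moreover have "real ((n + k - 1) choose k) * (x / (1 + x)) ^ k / (1 + x) ^ n
      = baskakov_basis k n x" for k
    by (simp add: baskakov_basis_def power_divide power_add mult.commute)
  ultimately show ?thesis using assms by simp
qed

lemma baskakov_basis_Suc:
  assumes "n \<ge> 1"
  shows "real (Suc k) * baskakov_basis (Suc k) n x = real n * x * baskakov_basis k (Suc n) x"
proof -
  obtain m where n: "n = Suc m" using assms by (cases n) auto
  have "real (Suc k) * real (Suc (m + k) choose Suc k)
        = real (Suc m) * real (Suc (m + k) choose k)"
  proof -
    have "Suc k * (Suc (m + k) choose Suc k) = Suc (m + k) * (m + k choose k)"
      by (rule Suc_times_binomial)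
    also have "\<dots> = Suc m * (Suc (m + k) choose k)"
      using binomial_absorb_comp[of "Suc (m + k)" k] by simp
    finally show ?thesis by (metis of_nat_mult)
  qed
  then show ?thesis
    by (simp add: baskakov_basis_def n del: binomial_Suc_Suc of_nat_Suc)
qed

lemma baskakov_factorial_moment_sums:
  assumes "n \<ge> 1" "x \<ge> 0"
  shows "(\<lambda>k. (\<Prod>i<r. real k - real i) * baskakov_basis k n x) sums (pochhammer (real n) r * x ^ r)"
  using assms(1)
proof (induction r arbitrary: n)
  case 0
  then show ?case using baskakov_basis_sums_1 assms(2) by simp
next
  case (Suc r)
  have "(\<lambda>k. (\<Prod>i<Suc r. real (Suc k) - real i) * baskakov_basis (Suc k) n x)
      = (\<lambda>k. real n * x * ((\<Prod>i<r. real k - real i) * baskakov_basis k (Suc n) x))"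
  proof
    fix k
    have "(\<Prod>i<Suc r. real (Suc k) - real i) = real (Suc k) * (\<Prod>i<r. real k - real i)"
      by (subst prod.lessThan_Suc_shift) simp
    then show "(\<Prod>i<Suc r. real (Suc k) - real i) * baskakov_basis (Suc k) n x
      = real n * x * ((\<Prod>i<r. real k - real i) * baskakov_basis k (Suc n) x)"
      using baskakov_basis_Suc[OF Suc.prems, of k x] by (simp add: mult_ac del: of_nat_Suc)
  qed
  moreover have "(\<lambda>k. real n * x * ((\<Prod>i<r. real k - real i) * baskakov_basis k (Suc n) x))
      sums (real n * x * (pochhammer (real (Suc n)) r * x ^ r))"
    by (intro sums_mult Suc.IH) simp
  moreover have "real n * x * (pochhammer (real (Suc n)) r * x ^ r)
      = pochhammer (real n) (Suc r) * x ^ Suc r"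
    unfolding pochhammer_rec by (simp add: add.commute mult_ac)
  ultimately have "(\<lambda>k. (\<Prod>i<Suc r. real (Suc k) - real i) * baskakov_basis (Suc k) n x)
      sums (pochhammer (real n) (Suc r) * x ^ Suc r)" by (simp only:)
  from sums_Suc[OF this]
  have "(\<lambda>k. (\<Prod>i<Suc r. real k - real i) * baskakov_basis k n x)
      sums (pochhammer (real n) (Suc r) * x ^ Suc r
        + (\<Prod>i<Suc r. real 0 - real i) * baskakov_basis 0 n x)" .
  moreover have "(\<Prod>i<Suc r. real 0 - real i) * baskakov_basis 0 n x = 0"
    by (subst prod.lessThan_Suc_shift) simp
  ultimately show ?case by (simp only: add_0_right)
qed

definition falling_poly :: "nat \<Rightarrow> nat \<Rightarrow> real poly" where
  "falling_poly n r = (\<Prod>i<r. [:- (real i / real n), 1:])"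

lemma poly_falling_poly: "poly (falling_poly n r) x = (\<Prod>i<r. x - real i / real n)"
  by (simp add: falling_poly_def poly_prod)

lemma degree_falling_poly [simp]: "degree (falling_poly n r) = r"
  unfolding falling_poly_def by (subst degree_prod_eq_sum_degree) auto

lemma coeff_falling_poly [simp]: "coeff (falling_poly n r) r = 1"
proof -
  have "lead_coeff (falling_poly n r) = 1"
    unfolding falling_poly_def lead_coeff_prod by simp
  then show ?thesis by simp
qed

lemma baskakov_falling_poly_sums:
  assumes "n \<ge> 1" "x \<ge> 0"
  shows "(\<lambda>k. poly (falling_poly n r) (real k / real n) * baskakov_basis k n x)
    sums poly (monom (pochhammer (real n) r / real n ^ r) r) x"
proof -
  have "poly (falling_poly n r) (real k / real n) = (\<Prod>i<r. real k - real i) / real n ^ r" for k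
    by (simp add: poly_falling_poly flip: diff_divide_distrib) (simp add: prod_dividef)
  then show ?thesis
    using sums_divide[OF baskakov_factorial_moment_sums[OF assms, of r], of "real n ^ r"]
    by (simp add: poly_monom)
qed

definition baskakov_sums :: "nat \<Rightarrow> real poly \<Rightarrow> real poly \<Rightarrow> bool" where
  "baskakov_sums n p q \<longleftrightarrow>
     (\<forall>x\<ge>0. (\<lambda>k. poly p (real k / real n) * baskakov_basis k n x) sums poly q x)"

lemma poly_eq_nonneg:
  fixes p q :: "real poly"
  assumes "\<And>x. x \<ge> 0 \<Longrightarrow> poly p x = poly q x"
  shows "p = q"
proof (rule ccontr)
  assume "p \<noteq> q"
  then have "finite {x. poly (p - q) x = 0}" by (intro poly_roots_finite) simp
  moreover have "{0..} \<subseteq> {x. poly (p - q) x = 0}" using assms by auto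
  ultimately show False using infinite_Ici[of "0::real"] finite_subset by blast
qed

lemma baskakov_sums_add:
  "baskakov_sums n p q \<Longrightarrow> baskakov_sums n p' q' \<Longrightarrow> baskakov_sums n (p + p') (q + q')"
  by (simp add: baskakov_sums_def distrib_right sums_add)

lemma baskakov_sums_smult:
  "baskakov_sums n p q \<Longrightarrow> baskakov_sums n (smult c p) (smult c q)"
  by (simp add: baskakov_sums_def mult.assoc sums_mult)

lemma baskakov_sums_unique: "baskakov_sums n p q \<Longrightarrow> baskakov_sums n p q' \<Longrightarrow> q = q'"
  by (rule poly_eq_nonneg) (auto simp: baskakov_sums_def dest: sums_unique2)

lemma baskakov_sums_imp: "baskakov_sums n p q \<Longrightarrow> baskakov_poly n p = q"
  unfolding baskakov_poly_def
  by (rule the_equality)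
     (auto simp: baskakov_sums_def baskakov_def sums_iff intro!: poly_eq_nonneg)

lemma degree_less_diff_smult:
  fixes p f :: "real poly"
  assumes "degree p = d" "degree f = d" "coeff f d = 1" "p \<noteq> smult (coeff p d) f"
  shows "degree (p - smult (coeff p d) f) < d"
proof -
  let ?r = "p - smult (coeff p d) f"
  have le: "degree ?r \<le> d" using assms by (intro degree_diff_le) (auto intro: order.trans[OF degree_smult_le])
  moreover have "degree ?r \<noteq> d"
  proof
    assume "degree ?r = d"
    moreover have "coeff ?r d = 0" using assms by simp
    ultimately have "?r = 0" by (metis leading_coeff_0_iff)
    then show False using assms by simp
  qed
  ultimately show ?thesis by simp
qed

lemma baskakov_sums_exists:
  assumes "n \<ge> 1"
  shows "\<exists>q. baskakov_sums n p q \<and> degree q = degree p \<and> (p \<noteq> 0 \<longrightarrow> q \<noteq> 0)"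
proof (induction "degree p" arbitrary: p rule: less_induct)
  case less
  define d where "d = degree p"
  define c where "c = coeff p d"
  define e where "e = pochhammer (real n) d / real n ^ d"
  have e: "e > 0" using assms by (auto simp: e_def pochhammer_pos)
  let ?f = "falling_poly n d" and ?r = "p - smult (coeff p d) (falling_poly n d)"
  have F: "baskakov_sums n (smult c ?f) (smult c (monom e d))"
    by (rule baskakov_sums_smult)
       (use baskakov_falling_poly_sums[OF assms] in \<open>auto simp: baskakov_sums_def e_def\<close>)
  show ?case
  proof (cases "p = smult c ?f")
    case True
    then have "degree (smult c (monom e d)) = degree p \<and> (p \<noteq> 0 \<longrightarrow> smult c (monom e d) \<noteq> 0)"
      using e by (cases "c = 0") (auto simp: degree_monom_eq degree_smult_eq smult_monom d_def)
    with F True show ?thesis by metis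
  next
    case False
    then have lt: "degree ?r < d"
      by (intro degree_less_diff_smult) (auto simp: d_def c_def)
    then obtain q where q: "baskakov_sums n ?r q" "degree q = degree ?r"
      using less.hyps[of ?r] by (auto simp: d_def)
    have d0: "d > 0" using lt by simp
    then have c0: "c \<noteq> 0" by (auto simp: c_def d_def)
    let ?q = "smult c (monom e d) + q"
    have "baskakov_sums n p ?q" using baskakov_sums_add[OF F q(1)] by (simp add: c_def)
    moreover have "degree (smult c (monom e d)) = d"
      using c0 e by (simp add: degree_monom_eq smult_monom)
    then have "degree ?q = d" using lt q(2) by (simp add: degree_add_eq_left)
    moreover from this d0 have "?q \<noteq> 0" by auto
    ultimately show ?thesis by (auto simp: d_def)
  qed
qed

lemma baskakov_sums_baskakov_poly:
  "n \<ge> 1 \<Longrightarrow> baskakov_sums n p (baskakov_poly n p)"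
  using baskakov_sums_exists[of n p] baskakov_sums_imp by blast

lemma degree_baskakov_poly: "n \<ge> 1 \<Longrightarrow> degree (baskakov_poly n p) = degree p"
  using baskakov_sums_exists[of n p] baskakov_sums_imp by blast

lemma baskakov_poly_add:
  "n \<ge> 1 \<Longrightarrow> baskakov_poly n (p + q) = baskakov_poly n p + baskakov_poly n q"
  by (intro baskakov_sums_imp baskakov_sums_add baskakov_sums_baskakov_poly)

lemma baskakov_poly_smult:
  "n \<ge> 1 \<Longrightarrow> baskakov_poly n (smult c p) = smult c (baskakov_poly n p)"
  by (intro baskakov_sums_imp baskakov_sums_smult baskakov_sums_baskakov_poly)

lemma baskakov_poly_falling_poly:
  "n \<ge> 1 \<Longrightarrow> baskakov_poly n (falling_poly n r) = monom (pochhammer (real n) r / real n ^ r) r"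
  using baskakov_falling_poly_sums by (intro baskakov_sums_imp) (auto simp: baskakov_sums_def)

lemma bij_baskakov_poly:
  assumes "n \<ge> 1"
  shows "bij (baskakov_poly n)"
proof (rule bijI)
  show "inj (baskakov_poly n)"
  proof (rule injI)
    fix p q assume eq: "baskakov_poly n p = baskakov_poly n q"
    have "baskakov_poly n (p - q) = baskakov_poly n p + baskakov_poly n (smult (- 1) q)"
      by (simp flip: baskakov_poly_add[OF assms])
    also have "\<dots> = 0" using eq by (simp only: baskakov_poly_smult[OF assms]) simp
    finally have "baskakov_poly n (p - q) = 0" .
    then show "p = q" using baskakov_sums_exists[OF assms, of "p - q"] baskakov_sums_imp[of n "p - q"]
      by (metis right_minus_eq)
  qed
  have "\<exists>p. baskakov_poly n p = q" for q
  proof (induction "degree q" arbitrary: q rule: less_induct)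
    case less
    define d where "d = degree q"
    define e where "e = pochhammer (real n) d / real n ^ d"
    have e: "e > 0" using assms by (auto simp: e_def pochhammer_pos)
    let ?c = "coeff q d"
    let ?f = "smult (?c / e) (falling_poly n d)"
    have F: "baskakov_poly n ?f = smult ?c (monom 1 d)"
      using e by (simp add: baskakov_poly_smult[OF assms] baskakov_poly_falling_poly[OF assms]
          smult_monom flip: e_def)
    show ?case
    proof (cases "q = smult ?c (monom 1 d)")
      case True
      with F show ?thesis by metis
    next
      case False
      have "degree (q - smult ?c (monom 1 d)) < d"
        by (rule degree_less_diff_smult) (use False in \<open>auto simp: d_def degree_monom_eq\<close>)
      then obtain p where p: "baskakov_poly n p = q - smult ?c (monom 1 d)"
        using less.hyps[of "q - smult ?c (monom 1 d)"] by (auto simp: d_def)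
      have "baskakov_poly n (?f + p) = q"
        by (simp only: baskakov_poly_add[OF assms] F p)
      then show ?thesis by blast
    qed
  qed
  then show "surj (baskakov_poly n)" unfolding surj_def by metis
qed

lemma pderiv_funpow_add: "(pderiv ^^ r) (p + q) = (pderiv ^^ r) p + (pderiv ^^ r) (q :: real poly)"
  by (induction r) (auto simp: pderiv_add)

lemma pderiv_funpow_smult: "(pderiv ^^ r) (smult c p) = smult c ((pderiv ^^ r) (p :: real poly))"
  by (induction r) (auto simp: pderiv_smult)

lemma degree_pderiv_funpow: "degree ((pderiv ^^ r) (p :: real poly)) = degree p - r"
  by (induction r) (auto simp: degree_pderiv)

lemma pderiv_funpow_eq_0: 
  assumes "degree p < r"
  shows "(pderiv ^^ r) (p :: real poly) = 0"
proof -
  obtain s where s: "r = Suc s" "degree p \<le> s" using assms by (cases r) auto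
  then have "degree ((pderiv ^^ s) p) = 0" by (simp add: degree_pderiv_funpow)
  then show ?thesis by (simp add: s pderiv_eq_0_iff)
qed

lemma pderiv_funpow_monom: "(pderiv ^^ r) (monom (1::real) r) = monom (fact r) 0"
proof -
  have "(pderiv ^^ j) (monom c j) = monom (c * fact j) 0" for c :: real and j
    by (induction j arbitrary: c) (simp_all add: funpow_Suc_right pderiv_monom mult_ac del: funpow.simps)
  from this[of r 1] show ?thesis by simp
qed

lemma diff_op_sum_cong:
  assumes "degree p \<le> N"
  shows "(\<Sum>r\<le>degree p. a r * (pderiv ^^ r) p) = (\<Sum>r\<le>N. a r * (pderiv ^^ r) (p :: real poly))"
  by (rule sum.mono_neutral_left) (use assms in \<open>auto simp: pderiv_funpow_eq_0\<close>)

lemma ex1_diff_op_rep: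
  assumes add: "\<And>p q. L (p + q) = L p + L q"
    and smult: "\<And>c p. L (smult c p) = smult c (L p)"
  shows "\<exists>!a. diff_op_rep L a"
proof -
  have key: "a r = smult (1 / fact r) (L (monom 1 r) - (\<Sum>s<r. a s * (pderiv ^^ s) (monom 1 r)))
      \<longleftrightarrow> L (monom 1 r) = (\<Sum>s\<le>r. a s * (pderiv ^^ s) (monom 1 r))" for a r
  proof -
    have 1: "(\<Sum>s\<le>r. a s * (pderiv ^^ s) (monom (1::real) r))
        = (\<Sum>s<r. a s * (pderiv ^^ s) (monom 1 r)) + smult (fact r) (a r)"
      by (simp add: pderiv_funpow_monom monom_0 flip: lessThan_Suc_atMost)
    have 2: "b = smult (1 / fact r) (c - t) \<longleftrightarrow> c = t + smult (fact r) b" for b c t :: "real poly"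
    proof -
      have "b = smult (1 / fact r) (c - t) \<longleftrightarrow> smult (fact r) b = c - t"
        by (auto dest: sym)
      then show ?thesis by (auto simp: algebra_simps)
    qed
    show ?thesis unfolding 1 by (rule 2)
  qed
  define G where "G = (\<lambda>(a :: nat \<Rightarrow> real poly) r.
    smult (1 / fact r) (L (monom 1 r) - (\<Sum>s<r. a s * (pderiv ^^ s) (monom 1 r))))"
  define a where "a = wfrec less_than G"
  have a: "a r = G a r" for r
  proof -
    have "adm_wf less_than G"
      by (auto simp: adm_wf_def G_def intro!: sum.cong arg_cong[where f = "\<lambda>z. smult _ (_ - z)"])
    then show ?thesis unfolding a_def by (subst wfrec_fixpoint) simp_all
  qed
  have mono: "L (monom 1 r) = (\<Sum>s\<le>r. a s * (pderiv ^^ s) (monom 1 r))" for r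
    using a[of r] key[of a r] unfolding G_def by blast
  have "L p = (\<Sum>r\<le>N. a r * (pderiv ^^ r) p)" if "degree p \<le> N" for p N
    using that
  proof (induction "degree p" arbitrary: p rule: less_induct)
    case less
    define d where "d = degree p"
    define c where "c = coeff p d"
    let ?r = "p - smult c (monom 1 d)"
    have sm: "smult c (\<Sum>r\<le>N. g r) = (\<Sum>r\<le>N. smult c (g r))" for g :: "nat \<Rightarrow> real poly"
      by (induction N) (auto simp: smult_add_right)
    have m: "L (smult c (monom 1 d)) = (\<Sum>r\<le>N. a r * (pderiv ^^ r) (smult c (monom 1 d)))"
      using mono[of d] diff_op_sum_cong[of "monom (1::real) d" N a] less.prems
      by (simp add: smult pderiv_funpow_smult sm degree_monom_eq d_def)
    show ?case
    proof (cases "p = smult c (monom 1 d)")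
      case True
      with m show ?thesis by simp
    next
      case False
      then have "degree ?r < d" unfolding c_def
        by (intro degree_less_diff_smult) (auto simp: d_def degree_monom_eq)
      then have r: "L ?r = (\<Sum>r\<le>N. a r * (pderiv ^^ r) ?r)"
        using less.hyps[of ?r] less.prems by (auto simp: d_def)
      have p: "p = smult c (monom 1 d) + ?r" by simp
      have "L p = L (smult c (monom 1 d)) + L ?r" by (subst p, subst add) simp
      also have "\<dots> = (\<Sum>r\<le>N. a r * (pderiv ^^ r) (smult c (monom 1 d) + ?r))"
        unfolding m r by (simp only: pderiv_funpow_add distrib_left sum.distrib)
      finally show ?thesis by simp
    qed
  qed
  then have "diff_op_rep L a" by (simp add: diff_op_rep_def)
  moreover have "b = a" if "diff_op_rep L b" for b
  proof
    fix r
    show "b r = a r"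
    proof (induction r rule: less_induct)
      case (less r)
      have "L (monom 1 r) = (\<Sum>s\<le>r. b s * (pderiv ^^ s) (monom 1 r))"
        using that unfolding diff_op_rep_def by (metis degree_monom_eq zero_neq_one)
      then have "b r = G b r" unfolding G_def using key[of b r] by blast
      also have "G b r = G a r" using less by (simp add: G_def)
      finally show ?case using a by simp
    qed
  qed
  ultimately show ?thesis by blast
qed

lemma diff_op_rep_theta:
  assumes "n \<ge> 1"
  shows "diff_op_rep (baskakov_poly n) (theta n)"
proof -
  have "\<exists>!a. diff_op_rep (baskakov_poly n) a"
    using assms by (intro ex1_diff_op_rep baskakov_poly_add baskakov_poly_smult)
  from theI'[OF this] show ?thesis by (simp add: theta_def[abs_def] diff_op_coeff_def)
qed

lemma diff_op_rep_eta:
  assumes "n \<ge> 1"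
  shows "diff_op_rep (inv (baskakov_poly n)) (eta n)"
proof -
  note b = bij_baskakov_poly[OF assms]
  have r: "baskakov_poly n (inv (baskakov_poly n) p) = p" for p
    using b by (simp add: bij_is_surj surj_f_inv_f)
  have l: "inv (baskakov_poly n) (baskakov_poly n p) = p" for p
    using b by (simp add: bij_is_inj)
  have "\<exists>!a. diff_op_rep (inv (baskakov_poly n)) a"
    by (intro ex1_diff_op_rep)
       (metis l r baskakov_poly_add[OF assms], metis l r baskakov_poly_smult[OF assms])
  from theI'[OF this] show ?thesis by (simp add: eta_def[abs_def] diff_op_coeff_def)
qed

end

theory Submission
  imports Defs
begin

text \<open>
  Let \<open>V\<close> be the Baskakov operator, \<open>U\<close> its inverse and \<open>X = x (1 + x)\<close>. Testing on the
  polynomials \<open>\<Prod>i<r. x - i/n\<close> gives the commutation relation \<open>V x - x V = (X/n) D V\<close>, hence also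
  \<open>U x - x U = - U (X/n) D\<close>. The commutator of \<open>\<Sum>a\<^sub>r D\<^sup>r\<close> with \<open>x\<close> is \<open>\<Sum>r a\<^sub>r D\<^sup>r\<^sup>-\<^sup>1\<close>, so comparing
  coefficients yields
  \<open>(r+2) \<theta>\<^sub>r\<^sub>+\<^sub>2 = (X/n) (\<theta>'\<^sub>r\<^sub>+\<^sub>1 + \<theta>\<^sub>r)\<close> and
  \<open>(r+2) (1 + (r+1)/n) \<eta>\<^sub>r\<^sub>+\<^sub>2 = - (X \<eta>\<^sub>r + (r+1) (1+2x) \<eta>\<^sub>r\<^sub>+\<^sub>1) / n\<close>,
  from which the limits follow by induction. As the first recurrence involves a derivative, its
  induction hypothesis is convergence of all derivatives.
\<close>

section \<open>Leibniz rules and uniqueness of coefficients\<close>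

abbreviation X_poly :: "real poly" where "X_poly \<equiv> [:0, 1, 1:]"

lemma diff_op_rep_eq_sum:
  "diff_op_rep L a \<Longrightarrow> degree p \<le> N \<Longrightarrow> L p = (\<Sum>r\<le>N. a r * (pderiv ^^ r) p)"
  unfolding diff_op_rep_def using diff_op_sum_cong[of p N a] by simp

lemma diff_op_rep_add:
  assumes "diff_op_rep L a"
  shows "L (p + q) = L p + L q"
proof -
  let ?N = "max (degree p) (degree q)"
  have "degree (p + q) \<le> ?N" by (simp add: degree_add_le_max)
  then show ?thesis
    by (simp add: diff_op_rep_eq_sum[OF assms, of _ ?N] pderiv_funpow_add distrib_left sum.distrib)
qed

lemma smult_sum_right: "smult c (\<Sum>i\<in>A. f i) = (\<Sum>i\<in>A. smult c (f i))"
  using sum_distrib_left[of "[:c:]" f A] by simp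

lemma diff_op_rep_smult:
  assumes "diff_op_rep L a"
  shows "L (smult c p) = smult c (L p)"
  using diff_op_rep_eq_sum[OF assms, of p "degree p"]
    diff_op_rep_eq_sum[OF assms, of "smult c p" "degree p"]
  by (simp add: pderiv_funpow_smult smult_sum_right)

text \<open>A representation by coefficients already makes \<open>L\<close> linear, so
  \<open>ex1_diff_op_rep\<close> applies. This is what licenses comparing coefficients.\<close>

lemma diff_op_rep_unique:
  assumes "diff_op_rep L a" "diff_op_rep L b"
  shows "a = b"
  using ex1_diff_op_rep[of L] diff_op_rep_add[OF assms(1)] diff_op_rep_smult[OF assms(1)] assms
  by blast

text \<open>Leibniz rule for x p, encoded as \<open>pCons 0 p\<close>: the second derivative of x
  vanishes, so two terms remain. At \<open>r = 0\<close> the truncated \<open>r - 1\<close> is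
  harmless because its factor \<open>of_nat r\<close> is zero.\<close>

lemma pderiv_funpow_pCons_0:
  "(pderiv ^^ r) (pCons 0 p) =
     pCons 0 ((pderiv ^^ r) p) + of_nat r * (pderiv ^^ (r - 1)) (p :: real poly)"
proof (induction r)
  case (Suc r)
  have "of_nat r * pderiv ((pderiv ^^ (r - 1)) p) = of_nat r * (pderiv ^^ r) p"
    by (cases r) simp_all
  moreover have "pderiv (of_nat r * q) = of_nat r * pderiv q" for q :: "real poly"
    by (simp add: of_nat_poly pderiv_smult)
  ultimately show ?case
    by (simp add: Suc pderiv_add pderiv_pCons distrib_right)
qed simp

lemma X_poly_mult: "X_poly * p = pCons 0 p + pCons 0 (pCons 0 p)"
  by simp

text \<open>The Leibniz terms of X, X' and X'' = 2, the last with factor 2 (r choose 2) = r (r - 1).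
  They arise by using the rule for x once on x p and twice on x^2 p.\<close>

lemma pderiv_funpow_X_poly_mult:
  "(pderiv ^^ r) (X_poly * p) =
     X_poly * (pderiv ^^ r) p + of_nat r * [:1, 2:] * (pderiv ^^ (r - 1)) p
       + of_nat r * of_nat (r - 1) * (pderiv ^^ (r - 2)) p"
proof -
  have x: "pCons 0 q = [:0, 1:] * q" for q :: "real poly" by simp
  have X: "X_poly = [:0, 1:] + [:0, 1:] * [:0, 1:]" and Y: "[:1, 2:] = 1 + ([:0, 1:] + [:0, 1 :: real:])"
    by (simp_all add: one_pCons)
  show ?thesis
    unfolding X_poly_mult pderiv_funpow_add pderiv_funpow_pCons_0
    \<comment> \<open>The instances of \<open>x\<close> are restricted so that literals such as
      \<open>[:0, 1:]\<close>, themselves built with \<open>pCons 0\<close>, are not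
      rewritten.\<close>
    unfolding x[of "(pderiv ^^ _) _"] x[of "_ + _"] x[of "_ * _"] X Y
    unfolding diff_diff_left one_add_one
    by (simp only: algebra_simps mult_1_left)
qed

section \<open>Commutation of the Baskakov operator with multiplication by x\<close>

text \<open>A basis argument: \<open>falling_poly n r\<close> is monic of degree \<open>r\<close>,
  so subtracting the right multiple of it lowers the degree.\<close>

lemma linear_eq_on_falling_poly:
  fixes L M :: "real poly \<Rightarrow> real poly"
  assumes L: "\<And>p q. L (p + q) = L p + L q" "\<And>c p. L (smult c p) = smult c (L p)"
    and M: "\<And>p q. M (p + q) = M p + M q" "\<And>c p. M (smult c p) = smult c (M p)"
    and eq: "\<And>r. L (falling_poly n r) = M (falling_poly n r)"
  shows "L p = M p"
proof (induction "degree p" arbitrary: p rule: less_induct)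
  case less
  define f where "f = smult (coeff p (degree p)) (falling_poly n (degree p))"
  have f: "L f = M f" by (simp add: f_def L M eq)
  show ?case
  proof (cases "p = f")
    case False
    then have "degree (p - f) < degree p"
      unfolding f_def by (intro degree_less_diff_smult) auto
    then have "L (f + (p - f)) = M (f + (p - f))"
      using less f unfolding L M by metis
    then show ?thesis by simp
  qed (metis f)
qed

text \<open>Let f_r be the falling polynomial and e_r x^r its image. Since x f_r = f_(r+1) + (r/n)
  f_r and e_(r+1) = e_r (1 + r/n), both sides at f_r equal e_r x^(r+1) + (r/n) e_r (x^r +
  x^(r+1)).\<close>

lemma baskakov_poly_pCons_0:
  assumes n: "n \<ge> 1"
  shows "baskakov_poly n (pCons 0 p) =
    pCons 0 (baskakov_poly n p) + smult (1 / real n) (X_poly * pderiv (baskakov_poly n p))"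
proof (rule linear_eq_on_falling_poly[where n = n
      and L = "\<lambda>p. baskakov_poly n (pCons 0 p)"
      and M = "\<lambda>p. pCons 0 (baskakov_poly n p)
        + smult (1 / real n) (X_poly * pderiv (baskakov_poly n p))"])
  fix r
  define e where "e = (\<lambda>r. pochhammer (real n) r / real n ^ r)"
  have V: "baskakov_poly n (falling_poly n r) = monom (e r) r" for r
    using baskakov_poly_falling_poly[OF n] by (simp add: e_def)
  have e: "e (Suc r) = e r + real r * e r / real n"
    using n by (simp add: e_def pochhammer_Suc field_simps)
  have "falling_poly n (Suc r) = [:- (real r / real n), 1:] * falling_poly n r"
    by (simp add: falling_poly_def mult.commute)
  then have "pCons 0 (falling_poly n r) = falling_poly n (Suc r) + smult (real r / real n) (falling_poly n r)"
    by simp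
  then have "baskakov_poly n (pCons 0 (falling_poly n r))
      = monom (e (Suc r)) (Suc r) + smult (real r / real n) (monom (e r) r)"
    by (simp only: baskakov_poly_add[OF n] baskakov_poly_smult[OF n] V)
  also have "\<dots> = pCons 0 (monom (e r) r) + smult (1 / real n) (X_poly * pderiv (monom (e r) r))"
    using e by (cases r; intro poly_eqI)
      (auto simp: pderiv_monom coeff_pCons algebra_simps add_divide_distrib split: nat.split)
  finally show "baskakov_poly n (pCons 0 (falling_poly n r)) =
     pCons 0 (baskakov_poly n (falling_poly n r)) +
       smult (1 / real n) (X_poly * pderiv (baskakov_poly n (falling_poly n r)))"
    by (simp only: V)
next
  fix p q
  have "pCons 0 (p + q) = pCons 0 p + pCons 0 (q :: real poly)" by simp
  then show "baskakov_poly n (pCons 0 (p + q)) = baskakov_poly n (pCons 0 p) + baskakov_poly n (pCons 0 q)"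
    by (simp only: baskakov_poly_add[OF n])
next
  fix c p
  have "pCons 0 (smult c p) = smult c (pCons (0 :: real) p)" by simp
  then show "baskakov_poly n (pCons 0 (smult c p)) = smult c (baskakov_poly n (pCons 0 p))"
    by (simp only: baskakov_poly_smult[OF n])
qed (simp_all add: baskakov_poly_add[OF n] baskakov_poly_smult[OF n] pderiv_add pderiv_smult
    algebra_simps smult_add_right)

section \<open>Coefficients of commutators and composites\<close>

text \<open>In the Leibniz expansion the terms containing x add up to x L p and cancel; the others
  are reindexed, the one at \<open>r = 0\<close> being zero.\<close>

lemma diff_op_rep_commutator:
  assumes "diff_op_rep L a"
  shows "diff_op_rep (\<lambda>p. L (pCons 0 p) - pCons 0 (L p)) (\<lambda>r. of_nat (Suc r) * a (Suc r))"
  unfolding diff_op_rep_def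
proof
  fix p :: "real poly"
  let ?N = "degree p"
  have x: "pCons 0 q = [:0, 1:] * q" for q :: "real poly" by simp
  have "L (pCons 0 p) = (\<Sum>r\<le>Suc ?N. a r * (pderiv ^^ r) (pCons 0 p))"
    by (rule diff_op_rep_eq_sum[OF assms]) (simp add: degree_pCons_le)
  also have "\<dots> = [:0, 1:] * (\<Sum>r\<le>Suc ?N. a r * (pderiv ^^ r) p)
      + (\<Sum>r\<le>Suc ?N. of_nat r * a r * (pderiv ^^ (r - 1)) p)"
    unfolding pderiv_funpow_pCons_0 x[of "(pderiv ^^ _) _"]
    by (simp only: sum_distrib_left distrib_left sum.distrib mult_ac)
  also have "(\<Sum>r\<le>Suc ?N. a r * (pderiv ^^ r) p) = L p"
    by (rule diff_op_rep_eq_sum[OF assms, symmetric]) simp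
  also have "(\<Sum>r\<le>Suc ?N. of_nat r * a r * (pderiv ^^ (r - 1)) p)
      = (\<Sum>r\<le>?N. of_nat (Suc r) * a (Suc r) * (pderiv ^^ r) p)"
    by (subst sum.atMost_Suc_shift) simp
  finally show "L (pCons 0 p) - pCons 0 (L p)
      = (\<Sum>r\<le>?N. of_nat (Suc r) * a (Suc r) * (pderiv ^^ r) p)" by simp
qed

text \<open>The index shift creates a term of order \<open>Suc (degree p)\<close>, which vanishes,
  so the sum can stay truncated where \<open>diff_op_rep\<close> demands it.\<close>

lemma sum_mult_pderiv_funpow_Suc:
  fixes p :: "real poly"
  shows "(\<Sum>r\<le>degree p. a r * (pderiv ^^ Suc r) p)
    = (\<Sum>r\<le>degree p. (if r = 0 then 0 else a (r - 1)) * (pderiv ^^ r) p)"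
proof -
  have "(\<Sum>r\<le>degree p. a r * (pderiv ^^ Suc r) p)
      = (\<Sum>r\<le>Suc (degree p). (if r = 0 then 0 else a (r - 1)) * (pderiv ^^ r) p)"
    by (simp add: sum.atMost_Suc_shift del: sum.atMost_Suc funpow.simps)
  then show ?thesis
    using pderiv_funpow_eq_0[of p "Suc (degree p)"] by simp
qed

text \<open>By the product rule, D (a_r D^r) = a_r' D^r + a_r D^(r+1). The conditional encodes
  a_(-1) = 0.\<close>

lemma diff_op_rep_X_poly_pderiv_left:
  assumes "diff_op_rep L a"
  shows "diff_op_rep (\<lambda>p. smult c (X_poly * pderiv (L p)))
    (\<lambda>r. smult c (X_poly * (pderiv (a r) + (if r = 0 then 0 else a (r - 1)))))"
  unfolding diff_op_rep_def
proof
  fix p :: "real poly"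
  let ?N = "degree p"
  have "pderiv (L p) = (\<Sum>r\<le>?N. pderiv (a r * (pderiv ^^ r) p))"
    using assms by (simp add: diff_op_rep_def higher_pderiv_sum[of 1, simplified])
  also have "\<dots> = (\<Sum>r\<le>?N. pderiv (a r) * (pderiv ^^ r) p) + (\<Sum>r\<le>?N. a r * (pderiv ^^ Suc r) p)"
    by (simp add: pderiv_mult sum.distrib algebra_simps)
  also have "\<dots> = (\<Sum>r\<le>?N. (pderiv (a r) + (if r = 0 then 0 else a (r - 1))) * (pderiv ^^ r) p)"
    unfolding sum_mult_pderiv_funpow_Suc by (simp only: sum.distrib distrib_right)
  finally show "smult c (X_poly * pderiv (L p)) = (\<Sum>r\<le>?N.
      smult c (X_poly * (pderiv (a r) + (if r = 0 then 0 else a (r - 1)))) * (pderiv ^^ r) p)"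
    by (simp only: sum_distrib_left smult_sum_right mult_smult_left mult.assoc)
qed

text \<open>Here D^r is moved past X, which yields derivatives of orders r + 1, r and r - 1. Hence
  the coefficient at D^r collects contributions of three neighbouring a's.\<close>

lemma diff_op_rep_X_poly_pderiv_right:
  assumes "diff_op_rep L a"
  shows "diff_op_rep (\<lambda>p. L (smult c (X_poly * pderiv p)))
    (\<lambda>r. smult c (X_poly * (if r = 0 then 0 else a (r - 1)) + of_nat r * [:1, 2:] * a r
       + of_nat (Suc r) * of_nat r * a (Suc r)))"
  unfolding diff_op_rep_def
proof
  fix p :: "real poly"
  let ?N = "degree p"
  have d: "degree (X_poly * pderiv p) \<le> Suc ?N"
  \<comment> \<open>For constant \<open>p\<close> the general degree estimate, with its truncated
    \<open>?N - 1\<close>, would give only 2; but then the derivative is zero.\<close>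
  proof (cases "?N = 0")
    case True
    then have "pderiv p = 0" by (simp add: pderiv_eq_0_iff)
    then show ?thesis by simp
  next
    case False
    then show ?thesis
      using degree_mult_le[of X_poly "pderiv p"] by (simp add: degree_pderiv)
  qed
  have D: "(pderiv ^^ r) (pderiv p) = (pderiv ^^ Suc r) p" for r
    by (simp add: funpow_swap1)
  have "L (X_poly * pderiv p) = (\<Sum>r\<le>Suc ?N. a r * (pderiv ^^ r) (X_poly * pderiv p))"
    by (rule diff_op_rep_eq_sum[OF assms d])
  also have "\<dots> = (\<Sum>r\<le>Suc ?N. X_poly * (a r * (pderiv ^^ Suc r) p)
      + of_nat r * [:1, 2:] * a r * (pderiv ^^ r) p
      + of_nat r * of_nat (r - 1) * a r * (pderiv ^^ (r - 1)) p)"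
  proof (rule sum.cong[OF refl])
    fix r
    \<comment> \<open>Where truncated subtraction makes the two orders differ, the numerical factor
      in front is zero.\<close>
    have 1: "of_nat r * (pderiv ^^ Suc (r - 1)) p = of_nat r * (pderiv ^^ r) p"
      by (cases r) simp_all
    have 2: "of_nat r * of_nat (r - 1) * (pderiv ^^ Suc (r - 2)) p
        = of_nat r * of_nat (r - 1) * (pderiv ^^ (r - 1)) p"
      by (cases "r \<le> 1") (auto simp: Suc_diff_le numeral_2_eq_2 Suc_diff_Suc le_Suc_eq)
    have "a r * (pderiv ^^ r) (X_poly * pderiv p) = X_poly * (a r * (pderiv ^^ Suc r) p)
      + [:1, 2:] * a r * (of_nat r * (pderiv ^^ Suc (r - 1)) p)
      + a r * (of_nat r * of_nat (r - 1) * (pderiv ^^ Suc (r - 2)) p)"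
      unfolding pderiv_funpow_X_poly_mult D by (simp only: distrib_left mult_ac)
    then show "a r * (pderiv ^^ r) (X_poly * pderiv p) = X_poly * (a r * (pderiv ^^ Suc r) p)
      + of_nat r * [:1, 2:] * a r * (pderiv ^^ r) p
      + of_nat r * of_nat (r - 1) * a r * (pderiv ^^ (r - 1)) p"
      unfolding 1 2 by (simp only: mult_ac)
  qed
  also have "\<dots> = X_poly * (\<Sum>r\<le>Suc ?N. a r * (pderiv ^^ Suc r) p)
      + (\<Sum>r\<le>Suc ?N. of_nat r * [:1, 2:] * a r * (pderiv ^^ r) p)
      + (\<Sum>r\<le>Suc ?N. of_nat r * of_nat (r - 1) * a r * (pderiv ^^ (r - 1)) p)"
    by (simp only: sum.distrib sum_distrib_left)
  also have "(\<Sum>r\<le>Suc ?N. a r * (pderiv ^^ Suc r) p)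
      = (\<Sum>r\<le>?N. (if r = 0 then 0 else a (r - 1)) * (pderiv ^^ r) p)"
    unfolding sum_mult_pderiv_funpow_Suc[symmetric]
    using pderiv_funpow_eq_0[of p "Suc (Suc ?N)"] by simp
  also have "(\<Sum>r\<le>Suc ?N. of_nat r * [:1, 2:] * a r * (pderiv ^^ r) p)
      = (\<Sum>r\<le>?N. of_nat r * [:1, 2:] * a r * (pderiv ^^ r) p)"
    using pderiv_funpow_eq_0[of p "Suc ?N"] by simp
  also have "(\<Sum>r\<le>Suc ?N. of_nat r * of_nat (r - 1) * a r * (pderiv ^^ (r - 1)) p)
      = (\<Sum>r\<le>?N. of_nat (Suc r) * of_nat r * a (Suc r) * (pderiv ^^ r) p)"
    by (subst sum.atMost_Suc_shift) simp
  finally have "L (X_poly * pderiv p) = (\<Sum>r\<le>?N.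
      (X_poly * (if r = 0 then 0 else a (r - 1)) + of_nat r * [:1, 2:] * a r
       + of_nat (Suc r) * of_nat r * a (Suc r)) * (pderiv ^^ r) p)"
    by (simp only: sum.distrib sum_distrib_left distrib_right mult.assoc)
  then show "L (smult c (X_poly * pderiv p)) = (\<Sum>r\<le>?N.
      smult c (X_poly * (if r = 0 then 0 else a (r - 1)) + of_nat r * [:1, 2:] * a r
       + of_nat (Suc r) * of_nat r * a (Suc r)) * (pderiv ^^ r) p)"
    by (simp only: diff_op_rep_smult[OF assms] smult_sum_right mult_smult_left)
qed

section \<open>Recurrences for the coefficients\<close>

lemma diff_op_rep_0:
  "diff_op_rep L a \<Longrightarrow> a 0 = L 1"
  by (simp add: diff_op_rep_def)

lemma baskakov_poly_1: "n \<ge> 1 \<Longrightarrow> baskakov_poly n 1 = 1"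
  using baskakov_poly_falling_poly[of n 0] by (simp add: falling_poly_def monom_0 one_pCons)

lemma theta_rec:
  assumes n: "n \<ge> 1"
  shows "of_nat (Suc r) * theta n (Suc r) =
    smult (1 / real n) (X_poly * (pderiv (theta n r) + (if r = 0 then 0 else theta n (r - 1))))"
proof -
  have "(\<lambda>p. baskakov_poly n (pCons 0 p) - pCons 0 (baskakov_poly n p))
      = (\<lambda>p. smult (1 / real n) (X_poly * pderiv (baskakov_poly n p)))"
    by (simp only: baskakov_poly_pCons_0[OF n] add_diff_cancel_left')
  then show ?thesis
    using diff_op_rep_commutator[OF diff_op_rep_theta[OF n]]
      diff_op_rep_X_poly_pderiv_left[OF diff_op_rep_theta[OF n], of "1 / real n"]
    by (metis (no_types, lifting) diff_op_rep_unique)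
qed

lemma theta_0: "n \<ge> 1 \<Longrightarrow> theta n 0 = 1"
  using diff_op_rep_0[OF diff_op_rep_theta] baskakov_poly_1 by simp

lemma theta_1: "n \<ge> 1 \<Longrightarrow> theta n 1 = 0"
  using theta_rec[of n 0] by (simp add: theta_0)

text \<open>The commutation relation is applied to \<open>?U p\<close>, where it reads V (x U p) = x
  p + (X/n) D p; then U is applied to both sides.\<close>

lemma inv_baskakov_poly_commutator:
  assumes n: "n \<ge> 1"
  shows "inv (baskakov_poly n) (pCons 0 p) - pCons 0 (inv (baskakov_poly n) p)
    = inv (baskakov_poly n) (smult (- 1 / real n) (X_poly * pderiv p))"
proof -
  let ?U = "inv (baskakov_poly n)"
  note b = bij_baskakov_poly[OF n] and U = diff_op_rep_eta[OF n]
  have VU: "baskakov_poly n (?U q) = q" for q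
    using b by (simp add: bij_is_surj surj_f_inv_f)
  have UV: "?U (baskakov_poly n q) = q" for q
    using b by (simp add: bij_is_inj)
  have "pCons 0 (?U p) = ?U (baskakov_poly n (pCons 0 (?U p)))" by (simp only: UV)
  also have "\<dots> = ?U (pCons 0 p) + smult (1 / real n) (?U (X_poly * pderiv p))"
    by (simp only: baskakov_poly_pCons_0[OF n] VU diff_op_rep_add[OF U] diff_op_rep_smult[OF U])
  finally show ?thesis by (simp only: diff_op_rep_smult[OF U]) simp
qed

text \<open>The Leibniz term from X'' puts \<open>eta n (Suc r)\<close> on both sides;
  \<open>eta_rec\<close> solves for it.\<close>

lemma eta_rec_poly:
  assumes n: "n \<ge> 1"
  shows "of_nat (Suc r) * eta n (Suc r) =
    smult (- 1 / real n) (X_poly * (if r = 0 then 0 else eta n (r - 1)) + of_nat r * [:1, 2:] * eta n r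
       + of_nat (Suc r) * of_nat r * eta n (Suc r))"
proof -
  have "(\<lambda>p. inv (baskakov_poly n) (pCons 0 p) - pCons 0 (inv (baskakov_poly n) p))
      = (\<lambda>p. inv (baskakov_poly n) (smult (- 1 / real n) (X_poly * pderiv p)))"
    by (simp only: inv_baskakov_poly_commutator[OF n])
  then show ?thesis
    using diff_op_rep_commutator[OF diff_op_rep_eta[OF n]]
      diff_op_rep_X_poly_pderiv_right[OF diff_op_rep_eta[OF n], of "- 1 / real n"]
    by (metis (no_types, lifting) diff_op_rep_unique)
qed

lemma eta_0:
  assumes n: "n \<ge> 1"
  shows "eta n 0 = 1"
  using diff_op_rep_0[OF diff_op_rep_eta[OF n]] baskakov_poly_1[OF n] bij_baskakov_poly[OF n]
  by (metis bij_is_inj inv_f_f)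

lemma eta_1: "n \<ge> 1 \<Longrightarrow> eta n 1 = 0"
  using eta_rec_poly[of n 0] by simp

text \<open>The collected factor (r + 2) (1 + (r + 1)/n) is positive, so it can be divided out. No
  derivative of a coefficient occurs, so values at a fixed point suffice.\<close>

lemma eta_rec:
  assumes n: "n \<ge> 1"
  shows "poly (eta n (Suc (Suc r))) x = - (1 / ((real r + 2) * (1 + (real r + 1) / real n))) / real n *
    (x * (1 + x) * poly (eta n r) x + (real r + 1) * (1 + 2 * x) * poly (eta n (Suc r)) x)"
proof -
  define A B where "A = poly (eta n (Suc (Suc r))) x"
    and "B = x * (1 + x) * poly (eta n r) x + (real r + 1) * (1 + 2 * x) * poly (eta n (Suc r)) x"
  have "(real r + 2) * A = - 1 / real n * (B + (real r + 2) * (real r + 1) * A)"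
    using arg_cong[OF eta_rec_poly[OF n, of "Suc r"], of "\<lambda>p. poly p x"]
    by (simp add: A_def B_def algebra_simps)
  then have "((real r + 2) * (1 + (real r + 1) / real n)) * A = - (B / real n)"
    by (simp add: algebra_simps add_divide_distrib)
  moreover have "(real r + 2) * (1 + (real r + 1) / real n) > 0"
    by (intro mult_pos_pos) (simp_all add: add_pos_nonneg)
  moreover have "a = - (1 / d) / N * b" if "d * a = - (b / N)" "d > 0" for a b d N :: real
  proof -
    have "a = d * a / d" using that(2) by simp
    also have "\<dots> = - (1 / d) / N * b" unfolding that(1) by simp
    finally show ?thesis .
  qed
  ultimately have "A = - (1 / ((real r + 2) * (1 + (real r + 1) / real n))) / real n * B"
    by blast
  then show ?thesis by (simp add: A_def B_def)
qed

section \<open>Limits for the inverse operator\<close>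

text \<open>The quotient s / s! absorbs the convention 1/(-1)! = 0, so the limit lemmas can use it
  without a case distinction.\<close>

lemma inv_fact_pred: "inv_fact (int s - 1) = real s / fact s"
  by (cases s) (simp_all add: inv_fact_def)

text \<open>Both parities are proved together because the recurrence mixes them. The odd index 2 s +
  1 belongs to r = s + 1 in the theorem.\<close>

lemma eta_limits:
  fixes x :: real
  defines "X \<equiv> x * (1 + x)"
  shows "(\<lambda>n. real n ^ s * poly (eta n (2 * s)) x) \<longlonglongrightarrow> (- 1) ^ s / (2 ^ s * fact s) * X ^ s \<and>
    (\<lambda>n. real n ^ Suc s * poly (eta n (Suc (2 * s))) x)
      \<longlonglongrightarrow> - 2 * (- 1) ^ s * real s / (3 * 2 ^ s * fact s) * (1 + 2 * x) * X ^ s"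
proof (induction s)
  case 0
  have "eventually (\<lambda>n. real n ^ 0 * poly (eta n (2 * 0)) x = 1) sequentially"
    by (intro eventually_sequentiallyI[of 1]) (simp add: eta_0)
  moreover have "eventually (\<lambda>n. real n ^ Suc 0 * poly (eta n (Suc (2 * 0))) x = 0) sequentially"
    by (intro eventually_sequentiallyI[of 1]) (simp add: eta_1[simplified])
  ultimately show ?case by (simp add: tendsto_eventually)
next
  case (Suc s)
  define H K where "H = (- 1) ^ s / (2 ^ s * fact s) * X ^ s"
    and "K = - 2 * (- 1) ^ s * real s / (3 * 2 ^ s * fact s) * (1 + 2 * x) * X ^ s"
  have e: "(\<lambda>n. real n ^ s * poly (eta n (2 * s)) x) \<longlonglongrightarrow> H"
    and o: "(\<lambda>n. real n ^ Suc s * poly (eta n (Suc (2 * s))) x) \<longlonglongrightarrow> K"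
    using Suc by (simp_all only: H_def K_def)
  have inv: "(\<lambda>n. 1 / real n) \<longlonglongrightarrow> 0" by (rule lim_1_over_n)
  have c: "(\<lambda>n. - (1 / ((real r + 2) * (1 + (real r + 1) / real n)))) \<longlonglongrightarrow> - (1 / (real r + 2))" for r
  proof -
    have "(\<lambda>n. - (1 / ((real r + 2) * (1 + (real r + 1) * (1 / real n)))))
        \<longlonglongrightarrow> - (1 / ((real r + 2) * (1 + (real r + 1) * 0)))"
      by (intro tendsto_intros inv) simp
    then show ?thesis by simp
  qed
  \<comment> \<open>In this normalisation the odd coefficient carries a spare factor 1/n, so only
    \<open>H\<close> survives.\<close>
  have e': "(\<lambda>n. real n ^ Suc s * poly (eta n (2 * Suc s)) x) \<longlonglongrightarrow> - (1 / (real (2 * s) + 2)) * (X * H)"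
  proof (rule Lim_transform_eventually)
    show "(\<lambda>n. - (1 / ((real (2 * s) + 2) * (1 + (real (2 * s) + 1) / real n))) *
        (X * (real n ^ s * poly (eta n (2 * s)) x) + (real (2 * s) + 1) * (1 + 2 * x) *
          (1 / real n * (real n ^ Suc s * poly (eta n (Suc (2 * s))) x))))
        \<longlonglongrightarrow> - (1 / (real (2 * s) + 2)) * (X * H)"
      by (rule tendsto_eq_intros c e o inv refl | simp)+
    show "\<forall>\<^sub>F n in sequentially. - (1 / ((real (2 * s) + 2) * (1 + (real (2 * s) + 1) / real n))) *
        (X * (real n ^ s * poly (eta n (2 * s)) x) + (real (2 * s) + 1) * (1 + 2 * x) *
          (1 / real n * (real n ^ Suc s * poly (eta n (Suc (2 * s))) x)))
        = real n ^ Suc s * poly (eta n (2 * Suc s)) x"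
    proof (rule eventually_sequentiallyI[of 1], goal_cases)
      case (1 n)
      then have n: "n \<ge> 1" .
      have alg: "C * (X * (N ^ s * a) + d * (1 / N * (N ^ Suc s * b)))
          = N ^ Suc s * (C / N * (X * a + d * b))" if "N \<noteq> 0" for N C a b d :: real
        using that by (simp add: field_simps)
      have "2 * Suc s = Suc (Suc (2 * s))" by simp
      then show ?case using n
        by (simp only: eta_rec[OF n, of "2 * s" x] X_def[symmetric]) (rule alg, simp)
    qed
  qed
  \<comment> \<open>Now both coefficients have the same order: \<open>K\<close> and the even limit
    just obtained contribute.\<close>
  have o': "(\<lambda>n. real n ^ Suc (Suc s) * poly (eta n (Suc (2 * Suc s))) x) \<longlonglongrightarrow>
      - (1 / (real (Suc (2 * s)) + 2)) * (X * K + (real (Suc (2 * s)) + 1) * (1 + 2 * x)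
        * (- (1 / (real (2 * s) + 2)) * (X * H)))"
  proof (rule Lim_transform_eventually)
    show "(\<lambda>n. - (1 / ((real (Suc (2 * s)) + 2) * (1 + (real (Suc (2 * s)) + 1) / real n))) *
        (X * (real n ^ Suc s * poly (eta n (Suc (2 * s))) x) + (real (Suc (2 * s)) + 1) * (1 + 2 * x) *
          (real n ^ Suc s * poly (eta n (2 * Suc s)) x)))
        \<longlonglongrightarrow> - (1 / (real (Suc (2 * s)) + 2)) * (X * K + (real (Suc (2 * s)) + 1) * (1 + 2 * x)
        * (- (1 / (real (2 * s) + 2)) * (X * H)))"
      by (intro tendsto_mult tendsto_add tendsto_const c o e')
    show "\<forall>\<^sub>F n in sequentially.
        - (1 / ((real (Suc (2 * s)) + 2) * (1 + (real (Suc (2 * s)) + 1) / real n))) *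
        (X * (real n ^ Suc s * poly (eta n (Suc (2 * s))) x) + (real (Suc (2 * s)) + 1) * (1 + 2 * x) *
          (real n ^ Suc s * poly (eta n (2 * Suc s)) x))
        = real n ^ Suc (Suc s) * poly (eta n (Suc (2 * Suc s))) x"
    proof (rule eventually_sequentiallyI[of 1], goal_cases)
      case (1 n)
      then have n: "n \<ge> 1" .
      have alg: "C * (X * (N ^ Suc s * a) + d * (N ^ Suc s * b))
          = N ^ Suc (Suc s) * (C / N * (X * a + d * b))" if "N \<noteq> 0" for N C a b d :: real
        using that by (simp add: field_simps)
      have i: "2 * Suc s = Suc (Suc (2 * s))" by simp
      show ?case using n
        by (simp only: i eta_rec[OF n, of "Suc (2 * s)" x] X_def[symmetric]) (rule alg, simp)
    qed
  qed
  have H': "- (1 / (real (2 * s) + 2)) * (X * H) = (- 1) ^ Suc s / (2 ^ Suc s * fact (Suc s)) * X ^ Suc s"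
    by (simp add: H_def field_simps)
  \<comment> \<open>With powers and factorials abstracted, the two contributions add up to a
    multiple of 2 S/3 + 1 = (2 S + 3)/3, which cancels the prefactor.\<close>
  have alg: "- (1 / (2 * S + 3)) * (X * (- 2 * m * S / (3 * t * f) * y * Z)
      + (2 * S + 2) * y * (- m / (2 * t * ((S + 1) * f)) * (X * Z)))
      = - 2 * (- m) * (S + 1) / (3 * (2 * t) * ((S + 1) * f)) * y * (X * Z)"
    if "S \<ge> 0" "f > 0" "t > 0" for S f t y m Z :: real
  proof -
    have "2 * S + 3 \<noteq> 0" "S + 1 \<noteq> 0" using that by simp_all
    then show ?thesis using that by (simp add: divide_simps) (simp add: algebra_simps)
  qed
  have "- (1 / (real (Suc (2 * s)) + 2)) * (X * K + (real (Suc (2 * s)) + 1) * (1 + 2 * x)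
        * (- (1 / (real (2 * s) + 2)) * (X * H)))
      = - 2 * (- 1) ^ Suc s * real (Suc s) / (3 * 2 ^ Suc s * fact (Suc s)) * (1 + 2 * x) * X ^ Suc s"
    unfolding H' using alg[of "real s" "fact s" "2 ^ s" "(- 1) ^ s" "1 + 2 * x" "X ^ s"]
    by (simp add: K_def add_ac)
  with e' o' H' show ?case by (simp only:)
qed

section \<open>Convergence of all derivatives\<close>

definition derivs_tendsto :: "(nat \<Rightarrow> real poly) \<Rightarrow> real poly \<Rightarrow> bool" where
  "derivs_tendsto p q \<longleftrightarrow>
     (\<forall>k x. (\<lambda>n. poly ((pderiv ^^ k) (p n)) x) \<longlonglongrightarrow> poly ((pderiv ^^ k) q) x)"

lemma derivs_tendsto_poly: "derivs_tendsto p q \<Longrightarrow> (\<lambda>n. poly (p n) x) \<longlonglongrightarrow> poly q x"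
  unfolding derivs_tendsto_def by (drule spec[of _ 0]) simp

lemma derivs_tendsto_pderiv: "derivs_tendsto p q \<Longrightarrow> derivs_tendsto (\<lambda>n. pderiv (p n)) (pderiv q)"
  unfolding derivs_tendsto_def
proof (intro allI)
  fix k x assume "\<forall>k x. (\<lambda>n. poly ((pderiv ^^ k) (p n)) x) \<longlonglongrightarrow> poly ((pderiv ^^ k) q) x"
  from this[rule_format, of "Suc k" x]
  show "(\<lambda>n. poly ((pderiv ^^ k) (pderiv (p n))) x) \<longlonglongrightarrow> poly ((pderiv ^^ k) (pderiv q)) x"
    by (simp add: funpow_swap1)
qed

lemma derivs_tendsto_const: "derivs_tendsto (\<lambda>_. p) p"
  by (simp add: derivs_tendsto_def)

lemma derivs_tendsto_add:
  "derivs_tendsto p q \<Longrightarrow> derivs_tendsto p' q' \<Longrightarrow> derivs_tendsto (\<lambda>n. p n + p' n) (q + q')"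
  by (auto simp: derivs_tendsto_def pderiv_funpow_add intro!: tendsto_add)

lemma derivs_tendsto_smult:
  "c \<longlonglongrightarrow> d \<Longrightarrow> derivs_tendsto p q \<Longrightarrow> derivs_tendsto (\<lambda>n. smult (c n) (p n)) (smult d q)"
  by (auto simp: derivs_tendsto_def pderiv_funpow_smult intro!: tendsto_mult)

text \<open>By the Leibniz rule each derivative of the product is a combination of three derivatives
  of \<open>p n\<close> whose coefficients do not depend on \<open>n\<close>.\<close>

lemma derivs_tendsto_X_poly_mult:
  "derivs_tendsto p q \<Longrightarrow> derivs_tendsto (\<lambda>n. X_poly * p n) (X_poly * q)"
  unfolding derivs_tendsto_def pderiv_funpow_X_poly_mult poly_add poly_mult
  by (intro allI tendsto_add tendsto_mult tendsto_const) simp_all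

text \<open>The recurrences hold for n >= 1 only, and the term at 0 does not affect a limit.\<close>

lemma derivs_tendsto_cong:
  assumes "derivs_tendsto p q" "\<And>n. n \<ge> 1 \<Longrightarrow> p n = p' n"
  shows "derivs_tendsto p' q"
  unfolding derivs_tendsto_def
proof (intro allI)
  fix k x
  have "eventually (\<lambda>n. poly ((pderiv ^^ k) (p n)) x = poly ((pderiv ^^ k) (p' n)) x) sequentially"
    by (intro eventually_sequentiallyI[of 1]) (simp add: assms(2))
  moreover have "(\<lambda>n. poly ((pderiv ^^ k) (p n)) x) \<longlonglongrightarrow> poly ((pderiv ^^ k) q) x"
    using assms(1) by (simp add: derivs_tendsto_def)
  ultimately show "(\<lambda>n. poly ((pderiv ^^ k) (p' n)) x) \<longlonglongrightarrow> poly ((pderiv ^^ k) q) x"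
    by (rule Lim_transform_eventually[rotated])
qed

section \<open>Limits for the Baskakov operator\<close>

lemma theta_rec_Suc_Suc:
  assumes n: "n \<ge> 1"
  shows "theta n (Suc (Suc r)) =
    smult (1 / (real (r + 2) * real n)) (X_poly * (pderiv (theta n (Suc r)) + theta n r))"
proof -
  have "smult (real (r + 2)) (theta n (Suc (Suc r))) =
    smult (1 / real n) (X_poly * (pderiv (theta n (Suc r)) + theta n r))"
    using theta_rec[OF n, of "Suc r"] by (simp only: of_nat_poly) simp
  from arg_cong[OF this, of "smult (1 / real (r + 2))"] show ?thesis
    by (simp del: mult_pCons_left)
qed

lemma theta_limits:
  "derivs_tendsto (\<lambda>n. smult (real n ^ s) (theta n (2 * s))) (smult (1 / (2 ^ s * fact s)) (X_poly ^ s)) \<and>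
   derivs_tendsto (\<lambda>n. smult (real n ^ Suc s) (theta n (Suc (2 * s))))
     (smult (real s / (3 * 2 ^ s * fact s)) ([:1, 2:] * X_poly ^ s))"
proof (induction s)
  case 0
  have "derivs_tendsto (\<lambda>n. smult (real n ^ 0) (theta n (2 * 0))) 1"
    by (rule derivs_tendsto_cong[OF derivs_tendsto_const]) (simp add: theta_0)
  moreover have "derivs_tendsto (\<lambda>n. smult (real n ^ Suc 0) (theta n (Suc (2 * 0)))) 0"
    by (rule derivs_tendsto_cong[OF derivs_tendsto_const]) (simp add: theta_1[simplified])
  ultimately show ?case by (simp add: one_pCons)
next
  case (Suc s)
  define H K where "H = smult (1 / (2 ^ s * fact s)) (X_poly ^ s)"
    and "K = smult (real s / (3 * 2 ^ s * fact s)) ([:1, 2:] * X_poly ^ s)"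
  define H' where "H' = smult (1 / (2 ^ Suc s * fact (Suc s))) (X_poly ^ Suc s)"
  have e: "derivs_tendsto (\<lambda>n. smult (real n ^ s) (theta n (2 * s))) H"
    and o: "derivs_tendsto (\<lambda>n. smult (real n ^ Suc s) (theta n (Suc (2 * s)))) K"
    using Suc by (simp_all only: H_def K_def)
  \<comment> \<open>The derivative term carries a spare factor 1/n and drops out; the
    \<open>smult 0\<close> in the limit records this.\<close>
  have "derivs_tendsto (\<lambda>n. smult (1 / real (2 * s + 2))
      (X_poly * (smult (1 / real n) (pderiv (smult (real n ^ Suc s) (theta n (Suc (2 * s)))))
        + smult (real n ^ s) (theta n (2 * s)))))
      (smult (1 / real (2 * s + 2)) (X_poly * (smult 0 (pderiv K) + H)))"
    by (intro derivs_tendsto_smult derivs_tendsto_X_poly_mult derivs_tendsto_add derivs_tendsto_pderiv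
        e o tendsto_const lim_1_over_n)
  also have "smult (1 / real (2 * s + 2)) (X_poly * (smult 0 (pderiv K) + H)) = H'"
    by (simp add: H_def H'_def field_simps del: mult_pCons_left)
  finally have e': "derivs_tendsto (\<lambda>n. smult (real n ^ Suc s) (theta n (2 * Suc s))) H'"
  proof (rule derivs_tendsto_cong)
    fix n :: nat assume n: "n \<ge> 1"
    have "2 * Suc s = Suc (Suc (2 * s))" by simp
    then show "smult (1 / real (2 * s + 2))
      (X_poly * (smult (1 / real n) (pderiv (smult (real n ^ Suc s) (theta n (Suc (2 * s)))))
        + smult (real n ^ s) (theta n (2 * s)))) = smult (real n ^ Suc s) (theta n (2 * Suc s))"
      using n by (simp only: theta_rec_Suc_Suc[OF n])
        (simp add: pderiv_smult smult_add_right distrib_left del: mult_pCons_left)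
  qed
  \<comment> \<open>Here the derivative of the new even coefficient has the same order as the odd
    one, so the limit involves the derivative of \<open>H'\<close>.\<close>
  have "derivs_tendsto (\<lambda>n. smult (1 / real (Suc (2 * s) + 2))
      (X_poly * (pderiv (smult (real n ^ Suc s) (theta n (2 * Suc s)))
        + smult (real n ^ Suc s) (theta n (Suc (2 * s))))))
      (smult (1 / real (Suc (2 * s) + 2)) (X_poly * (pderiv H' + K)))"
    by (intro derivs_tendsto_smult derivs_tendsto_X_poly_mult derivs_tendsto_add derivs_tendsto_pderiv
        e' o tendsto_const)
  then have o': "derivs_tendsto (\<lambda>n. smult (real n ^ Suc (Suc s)) (theta n (Suc (2 * Suc s))))
      (smult (1 / real (Suc (2 * s) + 2)) (X_poly * (pderiv H' + K)))"
  proof (rule derivs_tendsto_cong)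
    fix n :: nat assume n: "n \<ge> 1"
    have "2 * Suc s = Suc (Suc (2 * s))" by simp
    then show "smult (1 / real (Suc (2 * s) + 2))
      (X_poly * (pderiv (smult (real n ^ Suc s) (theta n (2 * Suc s)))
        + smult (real n ^ Suc s) (theta n (Suc (2 * s)))))
      = smult (real n ^ Suc (Suc s)) (theta n (Suc (2 * Suc s)))"
      using n by (simp only: theta_rec_Suc_Suc[OF n, of "Suc (2 * s)"])
        (simp add: pderiv_smult smult_add_right distrib_left del: mult_pCons_left)
  qed
  have X': "pderiv X_poly = [:1, 2:]" by (simp add: pderiv_pCons)
  have dH: "pderiv H' = smult (1 / (2 ^ Suc s * fact s)) ([:1, 2:] * X_poly ^ s)"
    unfolding H'_def pderiv_smult pderiv_power_Suc X'
    by (simp add: mult.commute[of _ "[:1, 2:]"] mult.assoc[of "2 :: real"]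
        del: mult_pCons_left mult_pCons_right)
  have "X_poly * (pderiv H' + K)
      = smult (1 / (2 ^ Suc s * fact s) + real s / (3 * 2 ^ s * fact s)) ([:1, 2:] * X_poly ^ Suc s)"
    unfolding dH K_def
    by (simp only: smult_add_left[symmetric] mult_smult_right power_Suc mult.left_commute)
  moreover have "1 / real (Suc (2 * s) + 2) * (1 / (2 ^ Suc s * fact s) + real s / (3 * 2 ^ s * fact s))
      = real (Suc s) / (3 * 2 ^ Suc s * fact (Suc s))"
  proof -
    \<comment> \<open>The bracket equals (2 S + 3)/(6 t f), so the prefactor cancels.\<close>
    have alg: "1 / (2 * S + 3) * (1 / (2 * t * f) + S / (3 * t * f)) = (S + 1) / (3 * (2 * t) * ((S + 1) * f))"
      if "S \<ge> 0" "f > 0" "t > 0" for S f t :: real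
    proof -
      have "2 * S + 3 \<noteq> 0" "S + 1 \<noteq> 0" using that by simp_all
      then show ?thesis using that by (simp add: divide_simps)
    qed
    show ?thesis using alg[of "real s" "fact s" "2 ^ s"] by (simp add: add_ac)
  qed
  ultimately have "smult (1 / real (Suc (2 * s) + 2)) (X_poly * (pderiv H' + K))
      = smult (real (Suc s) / (3 * 2 ^ Suc s * fact (Suc s))) ([:1, 2:] * X_poly ^ Suc s)"
    by (simp only: smult_smult)
  with e' o' show ?case by (simp only: H'_def)
qed

section \<open>Assembling the four limits\<close>

theorem theorem2:
  fixes r :: nat and x X :: real
  assumes "r \<ge> 1"
    and "X = x * (1 + x)"
  shows "((\<lambda>n. real n ^ r * poly (theta n (2 * r - 1)) x)
           \<longlonglongrightarrow> 1 / (3 * 2 ^ (r - 1)) * inv_fact (int r - 2) * (1 + 2 * x) * X ^ (r - 1)) \<and>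
         ((\<lambda>n. real n ^ r * poly (theta n (2 * r)) x)
           \<longlonglongrightarrow> 1 / (2 ^ r * fact r) * X ^ r) \<and>
         ((\<lambda>n. real n ^ r * poly (eta n (2 * r - 1)) x)
           \<longlonglongrightarrow> (- 1) ^ r / (3 * 2 powi (int r - 2)) * inv_fact (int r - 2) * (1 + 2 * x) * X ^ (r - 1)) \<and>
         ((\<lambda>n. real n ^ r * poly (eta n (2 * r)) x)
           \<longlonglongrightarrow> (- 1) ^ r / (2 ^ r * fact r) * X ^ r)"
proof -
  \<comment> \<open>Even indices use the limit lemmas at \<open>r\<close>, odd ones at
    \<open>s\<close>.\<close>
  obtain s where r: "r = Suc s" using assms(1) by (cases r) auto
  have i: "2 * r - 1 = Suc (2 * s)" "r - 1 = s" by (simp_all add: r)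
  have f: "inv_fact (int r - 2) = real s / fact s"
    using inv_fact_pred[of s] by (simp add: r)
  \<comment> \<open>At \<open>r = 1\<close> the exponent is negative; the half appearing here
    accounts for the factor 2 in the odd part of \<open>eta_limits\<close>.\<close>
  have p: "2 powi (int r - 2) = (2 ^ s / 2 :: real)"
    using power_int_diff[of "2 :: real" "int s" 1] by (simp add: r)
  have X: "poly X_poly x = X" by (simp add: assms(2) algebra_simps)
  show ?thesis
    using derivs_tendsto_poly[OF theta_limits[of r, THEN conjunct1], of x]
      derivs_tendsto_poly[OF theta_limits[of s, THEN conjunct2], of x]
      eta_limits[of r x, THEN conjunct1] eta_limits[of s x, THEN conjunct2]
    unfolding i f p poly_smult poly_mult poly_power X assms(2)[symmetric]
    by (simp add: r mult_ac)
qed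

end
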